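(* Let $G$ be a CHART group (compact Hausdorff admissible right topological group). Then $w(G)=\pi\chi(G)$.
   Context: A group $G$ with a topology is called right topological if all right shifts $\rho_h: G\to G$, $g\mapsto gh$ ($h\in G$), are continuous. The topological center $\Lambda(G)$ is the set of all $g\in G$ for which the left shift $\lambda_g: G\to G$, $h\mapsto gh$, is continuous. A right topological group $G$ is admissible if $\Lambda(G)$ is dense in $G$. A CHART group is a compact Hausdorff admissible right topological group. The weight of a space $X$ is $w(X)=\min\{|\mathcal B|: \mathcal B$ is a base for $X\}$. A family $\mathcal P$ of nonempty open subsets of $X$ is a $\pi$-base at $x\in X$ if for every neighborhood $U$ of $x$ there is $V\in\mathcal P$ with $V\subset U$. The $\pi$-character is $\pi\chi(x,X)=\min\{|\mathcal P|: \mathcal P$ is a $\pi$-base at $x\}$ and $\pi\chi(X)=\sup\{\pi\chi(x,X): x\in X\}$. Convention: the cardinal functions $w$ and $\pi\chi$ are taken to have infinite values, i.e. each finite value is replaced by $\omega$. *)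

theory Defs
  imports "HOL-Analysis.Analysis" "HOL-Algebra.Group"
begin

(* notations of Set_Algebras and Congruence that make =o and closure_of ambiguous *)
no_notation elt_set_eq (infix "=o" 50)
no_notation eq_closure_of ("closure'_of\<index>")
unbundle cardinal_syntax

section \<open>Minima and suprema of cardinals\<close>

text \<open>
  Cardinals are the cardinal orders of the BNF library, considered up to \<open>=o\<close>.
  A minimum or supremum is therefore a chosen representative; the lemmas below show that it is
  well defined up to \<open>=o\<close>.
\<close>

definition cardinal_min :: "'b rel set \<Rightarrow> 'b rel" where
  "cardinal_min R = (SOME r. r \<in> R \<and> (\<forall>s\<in>R. r \<le>o s))"

lemma cardinal_min:
  assumes "R \<noteq> {}" "\<And>r. r \<in> R \<Longrightarrow> Card_order r"
  shows "cardinal_min R \<in> R" "\<And>s. s \<in> R \<Longrightarrow> cardinal_min R \<le>o s"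
proof -
  have "\<exists>r. r \<in> R \<and> (\<forall>s\<in>R. r \<le>o s)"
    using exists_minim_Card_order[of R] assms by blast
  from someI_ex[OF this]
  show "cardinal_min R \<in> R" "\<And>s. s \<in> R \<Longrightarrow> cardinal_min R \<le>o s"
    unfolding cardinal_min_def by blast+
qed

text \<open>
  The least cardinal bounding all members of \<open>R\<close>. Searching for it among the cardinals on the same
  type \<open>'b\<close> is no restriction: \<open>|UNIV :: 'b set|\<close> is an upper bound, and the result is below
  every upper bound on any other type (lemma \<open>cardinal_sup_least\<close>).
\<close>

definition cardinal_sup :: "'b rel set \<Rightarrow> 'b rel" where
  "cardinal_sup R = cardinal_min {s. Card_order s \<and> (\<forall>r\<in>R. r \<le>o s)}"

lemma cardinal_sup:
  fixes R :: "'b rel set"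
  assumes "\<And>r. r \<in> R \<Longrightarrow> Card_order r"
  shows "Card_order (cardinal_sup R)" "\<And>r. r \<in> R \<Longrightarrow> r \<le>o cardinal_sup R"
    "\<And>s :: 'b rel. Card_order s \<Longrightarrow> (\<And>r. r \<in> R \<Longrightarrow> r \<le>o s) \<Longrightarrow> cardinal_sup R \<le>o s"
proof -
  let ?U = "{s :: 'b rel. Card_order s \<and> (\<forall>r\<in>R. r \<le>o s)}"
  have "r \<le>o |UNIV :: 'b set|" if "r \<in> R" for r
    by (rule ordIso_ordLeq_trans[OF ordIso_symmetric[OF card_of_Field_ordIso[OF assms[OF that]]]
          card_of_mono1[OF subset_UNIV]])
  then have "|UNIV :: 'b set| \<in> ?U"
    by (simp add: card_of_Card_order)
  then have ne: "?U \<noteq> {}"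
    by blast
  have card: "Card_order s" if "s \<in> ?U" for s
    using that by simp
  have *: "cardinal_sup R \<in> ?U"
    unfolding cardinal_sup_def by (rule cardinal_min(1)[OF ne card])
  have **: "cardinal_sup R \<le>o s" if "s \<in> ?U" for s
    unfolding cardinal_sup_def by (rule cardinal_min(2)[OF ne card that])
  show "Card_order (cardinal_sup R)" "\<And>r. r \<in> R \<Longrightarrow> r \<le>o cardinal_sup R"
    using * by auto
  show "cardinal_sup R \<le>o s" if "Card_order s" "\<And>r. r \<in> R \<Longrightarrow> r \<le>o s" for s :: "'b rel"
    by (intro ** CollectI conjI ballI that)
qed

lemma cardinal_sup_least:
  fixes R :: "'b rel set" and t :: "'c rel"
  assumes R: "\<And>r. r \<in> R \<Longrightarrow> Card_order r"
    and t: "Card_order t" "\<And>r. r \<in> R \<Longrightarrow> r \<le>o t"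
  shows "cardinal_sup R \<le>o t"
proof (rule ccontr)
  assume "\<not> cardinal_sup R \<le>o t"
  then have less: "t <o cardinal_sup R"
    using cardinal_sup(1)[OF R] t(1)
    by (auto simp: card_order_on_def simp flip: not_ordLeq_iff_ordLess)
  then have "|Field t| \<le>o |Field (cardinal_sup R)|"
    by (intro card_of_mono2 ordLess_imp_ordLeq)
  then obtain f where f: "inj_on f (Field t)" "f ` Field t \<subseteq> Field (cardinal_sup R)"
    unfolding card_of_ordLeq[symmetric] by auto
  have "|Field t| =o |f ` Field t|"
    by (rule card_of_ordIsoI[OF inj_on_imp_bij_betw[OF f(1)]])
  then have eq: "t =o |f ` Field t|"
    by (rule ordIso_transitive[OF ordIso_symmetric[OF card_of_Field_ordIso[OF t(1)]]])
  have "cardinal_sup R \<le>o |f ` Field t|"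
    by (rule cardinal_sup(3)[OF R card_of_Card_order ordLeq_ordIso_trans[OF t(2) eq]])
  then have "cardinal_sup R \<le>o t"
    by (rule ordLeq_ordIso_trans[OF _ ordIso_symmetric[OF eq]])
  then show False
    using not_ordLess_ordLeq[OF less] by contradiction
qed

text \<open>
  Replacing finite values by \<open>\<omega>\<close>: adding \<open>natLeq\<close> does exactly this, and avoids the type mismatch
  that a case distinction between a cardinal on \<open>'b\<close> and \<open>natLeq\<close> would cause.
\<close>

definition infinite_value :: "'b rel \<Rightarrow> (nat + 'b) rel" where
  "infinite_value r = natLeq +c r"

lemma infinite_value_infinite:
  assumes "Card_order r" "infinite (Field r)"
  shows "infinite_value r =o r"
proof -
  have "Cinfinite r"
    using assms by (simp add: cinfinite_def)
  then show ?thesis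
    unfolding infinite_value_def by (intro csum_absorb2 natLeq_ordLeq_cinfinite)
qed

lemma infinite_value_finite:
  assumes "Card_order r" "finite (Field r)"
  shows "infinite_value r =o natLeq"
proof -
  have "r \<le>o natLeq"
    using assms by (intro ordLess_imp_ordLeq Cfinite_ordLess_Cinfinite natLeq_Cinfinite)
      (simp add: cfinite_def)
  then show ?thesis
    unfolding infinite_value_def by (intro csum_absorb1 natLeq_Cinfinite)
qed


section \<open>Weight and \<open>\<pi>\<close>-character\<close>

definition base_of :: "'a topology \<Rightarrow> 'a set set \<Rightarrow> bool" where
  "base_of X \<B> \<longleftrightarrow> (\<forall>V\<in>\<B>. openin X V) \<and>
     (\<forall>U x. openin X U \<and> x \<in> U \<longrightarrow> (\<exists>V\<in>\<B>. x \<in> V \<and> V \<subseteq> U))"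

definition weight :: "'a topology \<Rightarrow> (nat + 'a set) rel" where
  "weight X = infinite_value (cardinal_min {|\<B>| | \<B>. base_of X \<B>})"

definition pi_base_at :: "'a topology \<Rightarrow> 'a \<Rightarrow> 'a set set \<Rightarrow> bool" where
  "pi_base_at X x \<P> \<longleftrightarrow> (\<forall>V\<in>\<P>. openin X V \<and> V \<noteq> {}) \<and>
     (\<forall>U. (\<exists>W. openin X W \<and> x \<in> W \<and> W \<subseteq> U) \<longrightarrow> (\<exists>V\<in>\<P>. V \<subseteq> U))"

definition pi_character_at :: "'a topology \<Rightarrow> 'a \<Rightarrow> 'a set rel" where
  "pi_character_at X x = cardinal_min {|\<P>| | \<P>. pi_base_at X x \<P>}"

text \<open>
  Finite values are replaced only after taking the supremum; replacing them at every point first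
  would give the same result on nonempty spaces.
\<close>

definition pi_character :: "'a topology \<Rightarrow> (nat + 'a set) rel" where
  "pi_character X = infinite_value (cardinal_sup (pi_character_at X ` topspace X))"

lemma base_of_openin: "base_of X {U. openin X U}"
  unfolding base_of_def by blast

lemma pi_base_at_openin: "pi_base_at X x {U. openin X U \<and> U \<noteq> {}}"
  unfolding pi_base_at_def by blast

lemma Card_order_pi_character_at: "Card_order (pi_character_at X x)"
proof -
  let ?R = "{|\<P>| | \<P>. pi_base_at X x \<P>}"
  have "?R \<noteq> {}" "\<And>r. r \<in> ?R \<Longrightarrow> Card_order r"
    using pi_base_at_openin[of X x] by (auto simp: card_of_Card_order)
  from this(2)[OF cardinal_min(1)[OF this]] show ?thesis
    unfolding pi_character_at_def .
qed


section \<open>CHART groups\<close>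

locale right_topological_group = group G
  for G :: "('a, 'm) monoid_scheme" (structure) and T :: "'a topology" +
  assumes topspace_eq_carrier: "topspace T = carrier G"
    and continuous_right_shift: "h \<in> carrier G \<Longrightarrow> continuous_map T T (\<lambda>g. g \<otimes> h)"

definition topological_center :: "('a, 'm) monoid_scheme \<Rightarrow> 'a topology \<Rightarrow> 'a set" where
  "topological_center G T = {g \<in> carrier G. continuous_map T T (\<lambda>h. g \<otimes>\<^bsub>G\<^esub> h)}"

locale admissible_right_topological_group = right_topological_group +
  assumes dense_topological_center: "T closure_of topological_center G T = topspace T"

locale CHART_group = admissible_right_topological_group +
  assumes compact: "compact_space T"
    and Hausdorff: "Hausdorff_space T"

end

theory Submission
  imports Defs
begin

text \<open>
  That \<open>\<pi>\<chi>(G) \<le> w(G)\<close> holds in every space: the nonempty members of a base form a \<open>\<pi>\<close>-base at each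
  point. For the converse let \<open>P\<close> be a \<open>\<pi>\<close>-base at the identity with \<open>|P| \<le> \<kappa>\<close>, where \<open>\<kappa>\<close> is infinite.
  A compact space has weight at most \<open>\<kappa>\<close> as soon as \<open>\<kappa>\<close> many open sets contain disjoint
  neighbourhoods of any two distinct points (\<open>base_of_finite_intersections\<close>), so it suffices to
  build such a family from \<open>P\<close>.

  The first point is that \<open>\<Lambda>(G)\<close> contains a set \<open>D\<close> with at most \<open>\<kappa>\<close> elements that is dense in \<open>G\<close>
  (\<open>small_dense_central_set\<close>). For a nonempty open set \<open>U\<close>, the sets \<open>{g. d g \<in> U}\<close> with \<open>d \<in> \<Lambda>(G)\<close>
  are open, and they cover \<open>G\<close> because \<open>\<Lambda>(G)\<close> is dense and \<open>{d. d g \<in> U}\<close> is open for each \<open>g\<close>; so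
  by compactness finitely many \<open>d\<close> do. The set \<open>D\<close> consists of these \<open>d\<close> for all \<open>U \<in> P\<close>. It meets every
  neighbourhood of every \<open>w\<close>, since such a neighbourhood contains some \<open>U w\<close> with \<open>U \<in> P\<close>, and some
  chosen \<open>d\<close> satisfies \<open>d w\<^sup>-\<^sup>1 \<in> U\<close>.

  The second point is that right shifts, being continuous, move small members of \<open>P\<close> off themselves:
  if \<open>h\<close> is not the identity then some \<open>U \<in> P\<close> satisfies \<open>U h \<inter> U = \<emptyset>\<close>
  (\<open>pi_base_element_disjoint_from_right_translate\<close>). Given \<open>x \<noteq> y\<close>, take \<open>h = x\<^sup>-\<^sup>1 y\<close>; by
  regularity \<open>U\<close> contains a closed set \<open>C\<close> that includes a nonempty open set \<open>V\<close>. Density provides \<open>d \<in> D\<close> with \<open>d x \<in> V\<close>, and then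
  \<open>d y = d x h\<close> lies outside \<open>U\<close>. Hence the preimages under the left shift by \<open>d\<close> of \<open>V\<close> and of the
  complement of \<open>C\<close> separate \<open>x\<close> from \<open>y\<close>, and there are only \<open>\<kappa>\<close> such preimages.
\<close>

section \<open>Bases from point-separating families of open sets\<close>

lemma card_of_finite_ordLeq_Cinfinite:
  assumes "Cinfinite r" "finite A"
  shows "|A| \<le>o r"
  using assms card_of_Card_order[of A]
  by (intro ordLess_imp_ordLeq Cfinite_ordLess_Cinfinite) (auto simp: cfinite_def Field_card_of)

text \<open>
  Induction on the number of elements: each subset with \<open>n + 1\<close> elements arises by inserting one
  element into a subset with \<open>n\<close> elements, and an infinite cardinal absorbs products and countable
  unions.
\<close>

lemma card_of_finite_subsets_ordLeq:
  fixes S :: "'b set"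
  assumes r: "Cinfinite r" and S: "|S| \<le>o r"
  shows "|{F. finite F \<and> F \<subseteq> S}| \<le>o r"
proof -
  let ?K = "\<lambda>n. {F. finite F \<and> F \<subseteq> S \<and> card F = n}"
  have K: "|?K n| \<le>o r" for n
  proof (induction n)
    case 0
    have "?K 0 \<subseteq> {{}}"
      by auto
    then have "finite (?K 0)"
      by (rule finite_subset) simp
    then show ?case
      by (rule card_of_finite_ordLeq_Cinfinite[OF r])
  next
    case (Suc n)
    have "?K (Suc n) \<subseteq> (\<lambda>(x, F). insert x F) ` (S \<times> ?K n)"
    proof
      fix F assume F: "F \<in> ?K (Suc n)"
      then obtain x where x: "x \<in> F"
        by fastforce
      with F have "F - {x} \<in> ?K n" "x \<in> S" "F = insert x (F - {x})"
        by auto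
      then show "F \<in> (\<lambda>(x, F). insert x F) ` (S \<times> ?K n)"
        by blast
    qed
    then have "|?K (Suc n)| \<le>o |S \<times> ?K n|"
      by (meson card_of_image card_of_mono1 ordLeq_transitive)
    also have "|S \<times> ?K n| \<le>o r"
      using r S Suc.IH by (intro card_of_Times_ordLeq_infinite_Field) (auto simp: cinfinite_def)
    finally show ?case .
  qed
  have "{F. finite F \<and> F \<subseteq> S} = (\<Union>n. ?K n)"
    by auto
  moreover have "|UNIV :: nat set| \<le>o r"
    using r by (meson card_of_nat natLeq_ordLeq_cinfinite ordIso_ordLeq_trans)
  ultimately show ?thesis
    using UNION_Cinfinite_bound[of "UNIV :: nat set" r ?K] K r by auto
qed

text \<open>
  The topology generated by \<open>S\<close> is Hausdorff and coarser than the given compact topology, hence equal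
  to it. Concretely, the complement of a neighbourhood \<open>W\<close> of \<open>x\<close> is covered by finitely many members of
  \<open>S\<close>, each disjoint from a member of \<open>S\<close> around \<open>x\<close>; intersecting the latter gives a basic
  neighbourhood of \<open>x\<close> inside \<open>W\<close>. The empty intersection has to be read as the whole space.
\<close>

lemma base_of_finite_intersections:
  assumes "compact_space X"
    and S_open: "\<And>U. U \<in> S \<Longrightarrow> openin X U"
    and separated: "\<And>x y. x \<in> topspace X \<Longrightarrow> y \<in> topspace X \<Longrightarrow> x \<noteq> y \<Longrightarrow>
      \<exists>U\<in>S. \<exists>V\<in>S. x \<in> U \<and> y \<in> V \<and> disjnt U V"
  shows "base_of X ((\<lambda>F. topspace X \<inter> \<Inter>F) ` {F. finite F \<and> F \<subseteq> S})"
  unfolding base_of_def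
proof (intro conjI allI impI ballI)
  fix B assume "B \<in> (\<lambda>F. topspace X \<inter> \<Inter>F) ` {F. finite F \<and> F \<subseteq> S}"
  then obtain F where F: "finite F" "F \<subseteq> S" "B = topspace X \<inter> \<Inter>F"
    by auto
  from F(1,2) have "openin X (topspace X \<inter> \<Inter>F)"
  proof (induction rule: finite_induct)
    case (insert U F)
    then have "openin X (U \<inter> (topspace X \<inter> \<Inter>F))"
      using S_open by auto
    then show ?case
      by (simp add: Int_left_commute)
  qed simp
  then show "openin X B"
    using F by simp
next
  fix W x assume W: "openin X W \<and> x \<in> W"
  then have x: "x \<in> topspace X"
    using openin_subset by blast
  let ?C = "{V \<in> S. \<exists>U\<in>S. x \<in> U \<and> disjnt U V}"
  have "compactin X (topspace X - W)"
    using W assms(1) by (intro closedin_compact_space) auto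
  moreover have "topspace X - W \<subseteq> \<Union>?C"
  proof
    fix y assume "y \<in> topspace X - W"
    then show "y \<in> \<Union>?C"
      using separated[OF x, of y] W by blast
  qed
  moreover have "\<And>V. V \<in> ?C \<Longrightarrow> openin X V"
    using S_open by auto
  ultimately obtain F where F: "finite F" "F \<subseteq> ?C" "topspace X - W \<subseteq> \<Union>F"
    unfolding compactin_def by (metis (no_types, lifting))
  from F(2) have "\<forall>V\<in>F. \<exists>U. U \<in> S \<and> x \<in> U \<and> disjnt U V"
    by blast
  then obtain u where u: "\<And>V. V \<in> F \<Longrightarrow> u V \<in> S \<and> x \<in> u V \<and> disjnt (u V) V"
    by metis
  have "topspace X \<inter> \<Inter>(u ` F) \<subseteq> W"
    using F(3) u by (fastforce simp: disjnt_iff)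
  moreover have "x \<in> topspace X \<inter> \<Inter>(u ` F)"
    using u x by auto
  ultimately show "\<exists>B\<in>(\<lambda>F. topspace X \<inter> \<Inter>F) ` {F. finite F \<and> F \<subseteq> S}. x \<in> B \<and> B \<subseteq> W"
    using F(1) u by (intro bexI[of _ "topspace X \<inter> \<Inter>(u ` F)"]) auto
qed

section \<open>Density of the topological center and covering by translates\<close>

context right_topological_group
begin

lemma openin_right_shift_preimage:
  assumes "openin T U" "h \<in> carrier G"
  shows "openin T {g \<in> carrier G. g \<otimes> h \<in> U}"
  using openin_continuous_map_preimage[OF continuous_right_shift[OF assms(2)] assms(1)]
  by (simp add: topspace_eq_carrier)

lemma openin_left_shift_preimage:
  assumes "d \<in> topological_center G T" "openin T U"
  shows "openin T {g \<in> carrier G. d \<otimes> g \<in> U}"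
  using assms openin_continuous_map_preimage[of T T "\<lambda>h. d \<otimes> h" U]
  by (simp add: topspace_eq_carrier topological_center_def)

lemma openin_imp_subset_carrier: "openin T U \<Longrightarrow> U \<subseteq> carrier G"
  using openin_subset topspace_eq_carrier by metis

text \<open>
  This is how density of a set is used when only right shifts are continuous: the \<open>d\<close> with
  \<open>d \<otimes> g \<in> U\<close> form an open set, which is nonempty because right shifts are surjective.
\<close>

lemma dense_meets_right_translate:
  assumes dense: "T closure_of D = topspace T"
    and U: "openin T U" "U \<noteq> {}" and g: "g \<in> carrier G"
  shows "\<exists>d\<in>D. d \<otimes> g \<in> U"
proof -
  obtain u where u: "u \<in> U" "u \<in> carrier G"
    using U openin_imp_subset_carrier by blast
  have "u \<otimes> inv g \<in> {d \<in> carrier G. d \<otimes> g \<in> U}"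
    using u g by (simp add: m_assoc)
  then show ?thesis
    using dense openin_right_shift_preimage[OF U(1) g] unfolding dense_intersects_open by blast
qed

end

context CHART_group
begin

text \<open>
  Although left shifts are continuous only for central elements, there are enough of these to cover
  \<open>G\<close> by preimages of \<open>U\<close>; compactness then applies.
\<close>

lemma finitely_many_central_translates_cover:
  assumes U: "openin T U" "U \<noteq> {}"
  shows "\<exists>F. finite F \<and> F \<subseteq> topological_center G T \<and> (\<forall>g\<in>carrier G. \<exists>d\<in>F. d \<otimes> g \<in> U)"
proof -
  let ?W = "\<lambda>d. {g \<in> carrier G. d \<otimes> g \<in> U}"
  have "topspace T \<subseteq> \<Union>(?W ` topological_center G T)"
    using dense_meets_right_translate[OF dense_topological_center U]
    by (auto simp: topspace_eq_carrier)
  moreover have "\<forall>V \<in> ?W ` topological_center G T. openin T V"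
    using openin_left_shift_preimage U(1) by blast
  ultimately have "\<exists>\<F>. finite \<F> \<and> \<F> \<subseteq> ?W ` topological_center G T \<and> topspace T \<subseteq> \<Union>\<F>"
    by (intro compact[unfolded compact_space_alt, rule_format] conjI)
  then obtain \<F> where \<F>: "finite \<F>" "\<F> \<subseteq> ?W ` topological_center G T" "topspace T \<subseteq> \<Union>\<F>"
    by blast
  then obtain F where F: "F \<subseteq> topological_center G T" "finite F" "\<F> = ?W ` F"
    using finite_subset_image[OF \<F>(1,2)] by blast
  have "\<forall>g\<in>carrier G. \<exists>d\<in>F. d \<otimes> g \<in> U"
    using \<F>(3) unfolding F(3) topspace_eq_carrier by auto
  then show ?thesis
    using F(1,2) by (intro exI[of _ F] conjI)
qed

text \<open>
  The \<open>\<pi>\<close>-character at a single point thus controls the density of \<open>G\<close>, even within the topological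
  center.
\<close>

lemma small_dense_central_set:
  assumes P: "pi_base_at T \<one> P" and r: "Cinfinite r" "|P| \<le>o r"
  shows "\<exists>D \<subseteq> topological_center G T. T closure_of D = topspace T \<and> |D| \<le>o r"
proof -
  have "\<forall>U\<in>P. \<exists>F. finite F \<and> F \<subseteq> topological_center G T \<and> (\<forall>g\<in>carrier G. \<exists>d\<in>F. d \<otimes> g \<in> U)"
    using P by (intro ballI finitely_many_central_translates_cover) (auto simp: pi_base_at_def)
  then obtain F where F: "\<And>U. U \<in> P \<Longrightarrow> finite (F U)"
      "\<And>U. U \<in> P \<Longrightarrow> F U \<subseteq> topological_center G T"
      "\<And>U g. U \<in> P \<Longrightarrow> g \<in> carrier G \<Longrightarrow> \<exists>d\<in>F U. d \<otimes> g \<in> U"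
    by metis
  let ?D = "\<Union>U\<in>P. F U"
  have "?D \<inter> W \<noteq> {}" if W: "openin T W" "W \<noteq> {}" for W
  proof -
    obtain w where w: "w \<in> W" "w \<in> carrier G"
      using W openin_imp_subset_carrier by blast
    \<comment> \<open>The members of \<open>P\<close> are small near \<open>\<one>\<close> only, so \<open>W\<close> is moved there by the shift by \<open>w\<close>.\<close>
    have "\<one> \<in> {g \<in> carrier G. g \<otimes> w \<in> W}"
      using w by simp
    then obtain U where U: "U \<in> P" "U \<subseteq> {g \<in> carrier G. g \<otimes> w \<in> W}"
      using P openin_right_shift_preimage[OF W(1) w(2)] unfolding pi_base_at_def by blast
    \<comment> \<open>Covering at the point \<open>inv w\<close> is what lands \<open>d = d \<otimes> inv w \<otimes> w\<close> itself in \<open>W\<close>.\<close>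
    obtain d where d: "d \<in> F U" "d \<otimes> inv w \<in> U"
      using F(3)[OF U(1), of "inv w"] w by auto
    have "d \<in> carrier G"
      using d(1) F(2)[OF U(1)] by (auto simp: topological_center_def)
    then have "d \<otimes> inv w \<otimes> w = d"
      using w by (simp add: m_assoc)
    then have "d \<in> W"
      using d(2) U(2) by auto
    then show ?thesis
      using d(1) U(1) by blast
  qed
  then have "T closure_of ?D = topspace T"
    unfolding dense_intersects_open by blast
  moreover have "|?D| \<le>o r"
    using F(1) r by (intro UNION_Cinfinite_bound) (auto intro: card_of_finite_ordLeq_Cinfinite)
  moreover have "?D \<subseteq> topological_center G T"
    using F(2) by blast
  ultimately show ?thesis
    by (intro exI[of _ ?D] conjI)
qed

section \<open>The weight is bounded by the size of a local \<open>\<pi>\<close>-base\<close>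

text \<open>
  Separate \<open>\<one>\<close> and \<open>h\<close> by disjoint open sets \<open>A\<close> and \<open>B\<close>. By continuity of the right shift by \<open>h\<close>, some
  neighbourhood of \<open>\<one>\<close> inside \<open>A\<close> is shifted into \<open>B\<close>, and a member of \<open>P\<close> lies in that neighbourhood, even
  though it need not contain \<open>\<one>\<close>.
\<close>

lemma pi_base_element_disjoint_from_right_translate:
  assumes P: "pi_base_at T \<one> P" and h: "h \<in> carrier G" "h \<noteq> \<one>"
  shows "\<exists>U\<in>P. \<forall>u\<in>U. u \<otimes> h \<notin> U"
proof -
  obtain A B where AB: "openin T A" "openin T B" "\<one> \<in> A" "h \<in> B" "disjnt A B"
    using Hausdorff h unfolding Hausdorff_space_def topspace_eq_carrier by (metis one_closed)
  let ?W = "A \<inter> {g \<in> carrier G. g \<otimes> h \<in> B}"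
  have "openin T ?W" "\<one> \<in> ?W"
    using AB h openin_right_shift_preimage by auto
  then obtain U where "U \<in> P" "U \<subseteq> ?W"
    using P unfolding pi_base_at_def by blast
  then show ?thesis
    using AB(5) by (intro bexI[of _ U]) (auto simp: disjnt_iff)
qed

text \<open>
  Left shifts by \<open>d\<close> commute with right shifts, so a set that the right shift by \<open>inv x \<otimes> y\<close> moves off
  itself distinguishes \<open>d \<otimes> x\<close> from \<open>d \<otimes> y\<close> whenever it contains the former. The gap between
  \<open>V U\<close> and \<open>U\<close> turns this distinction into a separation by disjoint open sets.
\<close>

lemma small_separating_family:
  assumes P: "pi_base_at T \<one> P" and r: "Cinfinite r" "|P| \<le>o r"
  shows "\<exists>S. (\<forall>U\<in>S. openin T U) \<and> |S| \<le>o r \<and>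
    (\<forall>x\<in>topspace T. \<forall>y\<in>topspace T. x \<noteq> y \<longrightarrow> (\<exists>U\<in>S. \<exists>V\<in>S. x \<in> U \<and> y \<in> V \<and> disjnt U V))"
proof -
  obtain D where D: "D \<subseteq> topological_center G T" "T closure_of D = topspace T" "|D| \<le>o r"
    using small_dense_central_set[OF P r] by blast
  have regular: "neighbourhood_base_of (closedin T) T"
    using compact Hausdorff compact_Hausdorff_imp_regular_space neighbourhood_base_of_closedin by blast
  have "\<forall>U\<in>P. \<exists>V C. openin T V \<and> V \<noteq> {} \<and> closedin T C \<and> V \<subseteq> C \<and> C \<subseteq> U"
  proof
    fix U assume "U \<in> P"
    then obtain u where "openin T U" "u \<in> U"
      using P unfolding pi_base_at_def by blast
    then obtain V C where "openin T V" "closedin T C" "u \<in> V" "V \<subseteq> C" "C \<subseteq> U"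
      using regular[unfolded neighbourhood_base_of, rule_format, of U u] by blast
    then show "\<exists>V C. openin T V \<and> V \<noteq> {} \<and> closedin T C \<and> V \<subseteq> C \<and> C \<subseteq> U"
      by (intro exI[of _ V] exI[of _ C]) auto
  qed
  then obtain V C where VC: "\<And>U. U \<in> P \<Longrightarrow> openin T (V U) \<and> V U \<noteq> {} \<and> closedin T (C U) \<and> V U \<subseteq> C U \<and> C U \<subseteq> U"
    by metis
  let ?f = "\<lambda>(d, U). {g \<in> carrier G. d \<otimes> g \<in> V U}"
  let ?g = "\<lambda>(d, U). {g \<in> carrier G. d \<otimes> g \<in> topspace T - C U}"
  let ?S = "?f ` (D \<times> P) \<union> ?g ` (D \<times> P)"
  have DP: "|D \<times> P| \<le>o r"
    using r D(3) by (intro card_of_Times_ordLeq_infinite_Field) (auto simp: cinfinite_def)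
  have "|?S| \<le>o r"
    using r DP by (intro Un_Cinfinite_bound) (auto intro: ordLeq_transitive[OF card_of_image])
  moreover have "openin T W" if W: "W \<in> ?S" for W
  proof -
    consider d U where "d \<in> D" "U \<in> P" "W = {g \<in> carrier G. d \<otimes> g \<in> V U}"
      | d U where "d \<in> D" "U \<in> P" "W = {g \<in> carrier G. d \<otimes> g \<in> topspace T - C U}"
      using W by (elim UnE imageE) (auto simp del: Diff_iff)
    then show ?thesis
      using D(1) VC by cases (auto intro!: openin_left_shift_preimage simp del: Diff_iff)
  qed
  moreover have "\<exists>U\<in>?S. \<exists>V\<in>?S. x \<in> U \<and> y \<in> V \<and> disjnt U V"
    if xy: "x \<in> topspace T" "y \<in> topspace T" "x \<noteq> y" for x y
  proof -
    have x: "x \<in> carrier G" and y: "y \<in> carrier G"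
      using xy by (auto simp: topspace_eq_carrier)
    have "inv x \<otimes> y \<noteq> \<one>"
      using x y xy(3) by (metis inv_closed inv_equality inv_inv)
    then obtain U where U: "U \<in> P" "\<And>u. u \<in> U \<Longrightarrow> u \<otimes> (inv x \<otimes> y) \<notin> U"
      using pi_base_element_disjoint_from_right_translate[OF P, of "inv x \<otimes> y"] x y by auto
    obtain d where d: "d \<in> D" "d \<otimes> x \<in> V U"
      using dense_meets_right_translate[OF D(2), of "V U" x] VC[OF U(1)] x by blast
    have dG: "d \<in> carrier G"
      using d(1) D(1) by (auto simp: topological_center_def)
    have "d \<otimes> x \<otimes> (inv x \<otimes> y) = d \<otimes> y"
      using x y dG by (simp add: m_assoc inv_solve_left m_assoc[symmetric])
    then have "d \<otimes> y \<notin> U"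
      using U(2)[of "d \<otimes> x"] d(2) VC[OF U(1)] by auto
    then have "y \<in> ?g (d, U)"
      using VC[OF U(1)] y dG by (auto simp: topspace_eq_carrier)
    moreover have "x \<in> ?f (d, U)"
      using d x by simp
    moreover have "disjnt (?f (d, U)) (?g (d, U))"
      using VC[OF U(1)] by (auto simp: disjnt_iff)
    moreover have "?f (d, U) \<in> ?S" "?g (d, U) \<in> ?S"
      using d(1) U(1) by (blast intro: imageI)+
    ultimately show ?thesis
      by (intro bexI[of _ "?f (d, U)"] bexI[of _ "?g (d, U)"] conjI)
  qed
  ultimately show ?thesis
    by (intro exI[of _ ?S] conjI ballI impI)
qed

lemma small_base:
  assumes P: "pi_base_at T \<one> P" and r: "Cinfinite r" "|P| \<le>o r"
  shows "\<exists>\<B>. base_of T \<B> \<and> |\<B>| \<le>o r"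
proof -
  obtain S where S: "\<And>U. U \<in> S \<Longrightarrow> openin T U" "|S| \<le>o r"
    "\<And>x y. x \<in> topspace T \<Longrightarrow> y \<in> topspace T \<Longrightarrow> x \<noteq> y \<Longrightarrow>
      \<exists>U\<in>S. \<exists>V\<in>S. x \<in> U \<and> y \<in> V \<and> disjnt U V"
    using small_separating_family[OF P r] by metis
  let ?\<B> = "(\<lambda>F. topspace T \<inter> \<Inter>F) ` {F. finite F \<and> F \<subseteq> S}"
  have "base_of T ?\<B>"
    by (rule base_of_finite_intersections[OF compact S(1,3)])
  moreover have "|?\<B>| \<le>o r"
    by (rule ordLeq_transitive[OF card_of_image card_of_finite_subsets_ordLeq[OF r(1) S(2)]])
  ultimately show ?thesis
    by blast
qed

end

section \<open>Comparison of the two cardinal functions\<close>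

lemma pi_character_at_attained: "\<exists>P. pi_base_at X x P \<and> pi_character_at X x = |P|"
proof -
  let ?R = "{|P| | P. pi_base_at X x P}"
  have "cardinal_min ?R \<in> ?R"
    using pi_base_at_openin[of X x] by (intro cardinal_min(1)) (auto simp: card_of_Card_order)
  then show ?thesis
    unfolding pi_character_at_def by auto
qed

lemma pi_character_at_le: "pi_base_at X x P \<Longrightarrow> pi_character_at X x \<le>o |P|"
  unfolding pi_character_at_def by (rule cardinal_min(2)) (auto simp: card_of_Card_order)

lemma minimal_base_attained:
  "\<exists>\<B>. base_of X \<B> \<and> cardinal_min {|\<B>| | \<B>. base_of X \<B>} = |\<B>|"
proof -
  let ?R = "{|\<B>| | \<B>. base_of X \<B>}"
  have "cardinal_min ?R \<in> ?R"
    using base_of_openin[of X] by (intro cardinal_min(1)) (auto simp: card_of_Card_order)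
  then show ?thesis
    by auto
qed

lemma Cinfinite_infinite_value: "Card_order r \<Longrightarrow> Cinfinite (infinite_value r)"
  unfolding infinite_value_def by (intro Cinfinite_csum1 natLeq_Cinfinite)

lemma infinite_value_least:
  assumes "Card_order p" "Cinfinite r" "p \<le>o r"
  shows "infinite_value p \<le>o r"
  unfolding infinite_value_def
  by (intro csum_cinfinite_bound natLeq_ordLeq_cinfinite natLeq_Card_order assms)

lemma weight_le:
  assumes "base_of X \<B>" "Cinfinite r" "|\<B>| \<le>o r"
  shows "weight X \<le>o r"
proof -
  let ?m = "cardinal_min {|\<B>| | \<B>. base_of X \<B>}"
  have "?m \<le>o |\<B>|"
    using assms(1) by (intro cardinal_min(2)) (auto simp: card_of_Card_order)
  moreover have "Card_order ?m"
    using minimal_base_attained[of X] card_of_Card_order by metis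
  ultimately show ?thesis
    unfolding weight_def using assms(2,3)
    by (intro infinite_value_least) (auto intro: ordLeq_transitive)
qed

lemma pi_character_le_weight: "pi_character X \<le>o weight X"
proof -
  obtain \<B> where \<B>: "base_of X \<B>" "cardinal_min {|\<B>| | \<B>. base_of X \<B>} = |\<B>|"
    using minimal_base_attained by blast
  have "pi_character_at X x \<le>o |\<B>|" if "x \<in> topspace X" for x
  proof -
    have "pi_base_at X x (\<B> - {{}})"
      unfolding pi_base_at_def
    proof (intro conjI allI impI)
      fix U assume "\<exists>W. openin X W \<and> x \<in> W \<and> W \<subseteq> U"
      then obtain W where W: "openin X W" "x \<in> W" "W \<subseteq> U"
        by blast
      then obtain V where "V \<in> \<B>" "x \<in> V" "V \<subseteq> W"
        using \<B>(1) unfolding base_of_def by blast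
      then show "\<exists>V\<in>\<B> - {{}}. V \<subseteq> U"
        using W(3) by blast
    qed (use \<B>(1) in \<open>auto simp: base_of_def\<close>)
    from pi_character_at_le[OF this] show ?thesis
      by (rule ordLeq_transitive) (auto intro: card_of_mono1)
  qed
  then have "cardinal_sup (pi_character_at X ` topspace X) \<le>o |\<B>|"
    by (intro cardinal_sup_least) (auto simp: Card_order_pi_character_at card_of_Card_order)
  then show ?thesis
    unfolding pi_character_def weight_def infinite_value_def \<B>(2) by (rule csum_mono2)
qed

text \<open>
  A minimal \<open>\<pi>\<close>-base at the identity alone suffices, since its size is already below the supremum over
  all points.
\<close>

lemma (in CHART_group) weight_le_pi_character: "weight T \<le>o pi_character T"
proof -
  let ?R = "pi_character_at T ` topspace T"
  have sup: "Card_order (cardinal_sup ?R)"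
    by (intro cardinal_sup(1)) (auto simp: Card_order_pi_character_at)
  have inf: "Cinfinite (pi_character T)"
    unfolding pi_character_def using sup by (rule Cinfinite_infinite_value)
  obtain P where P: "pi_base_at T \<one> P" "pi_character_at T \<one> = |P|"
    using pi_character_at_attained[of T \<one>] by (elim exE conjE)
  have "pi_character_at T \<one> \<le>o cardinal_sup ?R"
    by (intro cardinal_sup(2)) (auto simp: Card_order_pi_character_at topspace_eq_carrier)
  also have "cardinal_sup ?R \<le>o pi_character T"
    unfolding pi_character_def infinite_value_def using sup by (rule ordLeq_csum2)
  finally have "|P| \<le>o pi_character T"
    unfolding P(2) .
  then show ?thesis
    using small_base[OF P(1) inf] weight_le[OF _ inf] by blast
qed

theorem theorem2:
  fixes G :: "('a, 'm) monoid_scheme" and T :: "'a topology"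
  assumes "CHART_group G T"
  shows "weight T =o pi_character T"
  using CHART_group.weight_le_pi_character[OF assms] pi_character_le_weight
  by (simp add: ordIso_iff_ordLeq)

end
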